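(* For every integer $k>1$, the free product with amalgamation $$\Gamma'_k=\langle G_k,\overline{G_k}\mid a_it=\overline{a_it},\ 1\le i\le k\rangle$$ is not residually finite, where $\overline{G_k}$ is a second copy of $G_k$ and $\overline{g}\in\overline{G_k}$ denotes the copy of $g\in G_k$.
   Context: Conventions: $a^b:=b^{-1}ab$. The hydra group is $G_k:=\langle a_1,\dots,a_k,t\mid a_1^t=a_1,\ a_i^t=a_ia_{i-1},\ 1<i\le k\rangle$, and $H_k:=\langle a_1t,\dots,a_kt\rangle\le G_k$. Thus $\Gamma'_k$ is the amalgamated free product of two copies of $G_k$ along the two copies of $H_k$, identified via $h\mapsto\overline{h}$. A group $G$ is residually finite if every $x\in G\setminus\{1\}$ has non-trivial image in some finite quotient of $G$. *)

theory Defs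
  imports "HOL-Algebra.Coset" "HOL-Algebra.Generated_Groups"
begin

section \<open>Groups given by generators and relations\<close>

text \<open>A letter \<open>(x, True)\<close> stands for the generator \<open>x\<close>, and \<open>(x, False)\<close> for its formal inverse.\<close>

type_synonym 'a gword = "('a \<times> bool) list"

abbreviation gwords :: "'a set \<Rightarrow> 'a gword set" where
  "gwords S \<equiv> lists (S \<times> UNIV)"

definition gword_inv :: "'a gword \<Rightarrow> 'a gword" where
  "gword_inv w = rev (map (\<lambda>(x, b). (x, \<not> b)) w)"

text \<open>The least congruence on the words over \<open>S\<close> that contains the free cancellations and
  the relations \<open>u = v\<close> for \<open>(u, v) \<in> R\<close>.\<close>

inductive pres_eq :: "'a set \<Rightarrow> ('a gword \<times> 'a gword) set \<Rightarrow> 'a gword \<Rightarrow> 'a gword \<Rightarrow> bool"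
  for S :: "'a set" and R :: "('a gword \<times> 'a gword) set" where
  refl: "w \<in> gwords S \<Longrightarrow> pres_eq S R w w"
| sym: "pres_eq S R u v \<Longrightarrow> pres_eq S R v u"
| trans: "pres_eq S R u v \<Longrightarrow> pres_eq S R v w \<Longrightarrow> pres_eq S R u w"
| append: "pres_eq S R u u' \<Longrightarrow> pres_eq S R v v' \<Longrightarrow> pres_eq S R (u @ v) (u' @ v')"
| cancel: "x \<in> S \<Longrightarrow> pres_eq S R [(x, b), (x, \<not> b)] []"
| rel: "(u, v) \<in> R \<Longrightarrow> u \<in> gwords S \<Longrightarrow> v \<in> gwords S \<Longrightarrow> pres_eq S R u v"

definition pres_class :: "'a set \<Rightarrow> ('a gword \<times> 'a gword) set \<Rightarrow> 'a gword \<Rightarrow> 'a gword set" where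
  "pres_class S R w = {v. pres_eq S R w v}"

definition presentation :: "'a set \<Rightarrow> ('a gword \<times> 'a gword) set \<Rightarrow> 'a gword set monoid" where
  "presentation S R =
    \<lparr>carrier = pres_class S R ` gwords S,
     mult = (\<lambda>U V. {w. \<exists>u\<in>U. \<exists>v\<in>V. pres_eq S R (u @ v) w}),
     one = pres_class S R []\<rparr>"

lemma pres_eq_gwords: "pres_eq S R u v \<Longrightarrow> u \<in> gwords S \<and> v \<in> gwords S"
  by (induction rule: pres_eq.induct) auto

lemma pres_class_eq_iff:
  assumes "u \<in> gwords S"
  shows "pres_class S R u = pres_class S R v \<longleftrightarrow> pres_eq S R u v"
proof
  assume "pres_class S R u = pres_class S R v"
  moreover have "u \<in> pres_class S R u"
    using assms by (simp add: pres_class_def pres_eq.refl)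
  ultimately show "pres_eq S R u v"
    by (auto simp: pres_class_def intro: pres_eq.sym)
next
  assume "pres_eq S R u v"
  then show "pres_class S R u = pres_class S R v"
    unfolding pres_class_def by (auto intro: pres_eq.sym pres_eq.trans)
qed

lemma carrier_presentation: "carrier (presentation S R) = pres_class S R ` gwords S"
  by (simp add: presentation_def)

lemma one_presentation: "\<one>\<^bsub>presentation S R\<^esub> = pres_class S R []"
  by (simp add: presentation_def)

lemma mult_presentation:
  assumes "u \<in> gwords S" "v \<in> gwords S"
  shows "pres_class S R u \<otimes>\<^bsub>presentation S R\<^esub> pres_class S R v = pres_class S R (u @ v)"
proof -
  have "(\<exists>u'\<in>pres_class S R u. \<exists>v'\<in>pres_class S R v. pres_eq S R (u' @ v') w)
      \<longleftrightarrow> pres_eq S R (u @ v) w" for w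
    using assms unfolding pres_class_def
    by (auto intro: pres_eq.refl pres_eq.append pres_eq.trans)
  then show ?thesis
    by (simp add: presentation_def) (simp add: pres_class_def)
qed

lemma gword_inv_closed: "w \<in> gwords S \<Longrightarrow> gword_inv w \<in> gwords S"
  by (auto simp: gword_inv_def in_lists_conv_set)

lemma pres_eq_gword_inv: "w \<in> gwords S \<Longrightarrow> pres_eq S R (gword_inv w @ w) []"
proof (induction w)
  case Nil
  show ?case by (simp add: gword_inv_def pres_eq.refl)
next
  case (Cons l w)
  obtain x b where l: "l = (x, b)" by (cases l)
  have x: "x \<in> S" and w: "w \<in> gwords S"
    using Cons.prems l by auto
  have "pres_eq S R ([(x, \<not> b), (x, \<not> \<not> b)] @ w) ([] @ w)"
    using x w by (intro pres_eq.append pres_eq.cancel pres_eq.refl)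
  then have "pres_eq S R (gword_inv w @ ([(x, \<not> b), (x, b)] @ w)) (gword_inv w @ w)"
    using gword_inv_closed [OF w] by (intro pres_eq.append pres_eq.refl) simp_all
  then show ?case
    using Cons.IH [OF w] l by (auto simp: gword_inv_def intro: pres_eq.trans)
qed

lemma group_presentation: "group (presentation S R)"
proof (rule groupI)
  fix U
  assume "U \<in> carrier (presentation S R)"
  then obtain u where u: "u \<in> gwords S" "U = pres_class S R u"
    by (auto simp: carrier_presentation)
  show "\<one>\<^bsub>presentation S R\<^esub> \<otimes>\<^bsub>presentation S R\<^esub> U = U"
    using u by (simp add: one_presentation mult_presentation)
  have "pres_class S R (gword_inv u) \<otimes>\<^bsub>presentation S R\<^esub> U = \<one>\<^bsub>presentation S R\<^esub>"
    using u gword_inv_closed [OF u(1)] pres_eq_gword_inv [OF u(1)]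
    by (simp add: one_presentation mult_presentation pres_class_eq_iff)
  then show "\<exists>V\<in>carrier (presentation S R). V \<otimes>\<^bsub>presentation S R\<^esub> U = \<one>\<^bsub>presentation S R\<^esub>"
    using gword_inv_closed [OF u(1)] by (auto simp: carrier_presentation)
next
  fix U V
  assume "U \<in> carrier (presentation S R)" "V \<in> carrier (presentation S R)"
  then obtain u v where uv: "u \<in> gwords S" "U = pres_class S R u" "v \<in> gwords S" "V = pres_class S R v"
    by (auto simp: carrier_presentation)
  then show "U \<otimes>\<^bsub>presentation S R\<^esub> V \<in> carrier (presentation S R)"
    by (simp add: mult_presentation carrier_presentation)
  fix W
  assume "W \<in> carrier (presentation S R)"
  then obtain w where "w \<in> gwords S" "W = pres_class S R w"
    by (auto simp: carrier_presentation)
  with uv show "U \<otimes>\<^bsub>presentation S R\<^esub> V \<otimes>\<^bsub>presentation S R\<^esub> W =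
      U \<otimes>\<^bsub>presentation S R\<^esub> (V \<otimes>\<^bsub>presentation S R\<^esub> W)"
    by (simp add: mult_presentation)
qed (auto simp: carrier_presentation one_presentation)

section \<open>Amalgamated products and residual finiteness\<close>

text \<open>The group \<open>\<langle>G, K | g = k for (g, k) \<in> E\<rangle>\<close>, where the generators are all elements of the
  disjoint union of \<open>G\<close> and \<open>K\<close>, subject to their multiplication tables and to the
  identifications in \<open>E\<close>. If \<open>E\<close> is the graph of an isomorphism between subgroups \<open>A \<le> G\<close> and
  \<open>B \<le> K\<close>, or the restriction of that graph to a generating set of \<open>A\<close>, this is the free product
  of \<open>G\<close> and \<open>K\<close> amalgamated along \<open>A \<cong> B\<close>.\<close>

definition amalgam_rels ::
    "('a, 'm) monoid_scheme \<Rightarrow> ('b, 'n) monoid_scheme \<Rightarrow> ('a \<times> 'b) set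
      \<Rightarrow> (('a + 'b) gword \<times> ('a + 'b) gword) set" where
  "amalgam_rels G K E =
     {([(Inl x, True), (Inl y, True)], [(Inl (x \<otimes>\<^bsub>G\<^esub> y), True)]) | x y. x \<in> carrier G \<and> y \<in> carrier G}
   \<union> {([(Inr x, True), (Inr y, True)], [(Inr (x \<otimes>\<^bsub>K\<^esub> y), True)]) | x y. x \<in> carrier K \<and> y \<in> carrier K}
   \<union> {([(Inl x, True)], [(Inr y, True)]) | x y. (x, y) \<in> E}"

definition amalgam ::
    "('a, 'm) monoid_scheme \<Rightarrow> ('b, 'n) monoid_scheme \<Rightarrow> ('a \<times> 'b) set
      \<Rightarrow> ('a + 'b) gword set monoid" where
  "amalgam G K E = presentation (carrier G <+> carrier K) (amalgam_rels G K E)"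

definition residually_finite :: "('a, 'm) monoid_scheme \<Rightarrow> bool" where
  "residually_finite G \<longleftrightarrow>
    (\<forall>x \<in> carrier G - {\<one>\<^bsub>G\<^esub>}.
       \<exists>N. N \<lhd> G \<and> finite (carrier (G Mod N)) \<and> N #>\<^bsub>G\<^esub> x \<noteq> \<one>\<^bsub>G Mod N\<^esub>)"

section \<open>Hydra groups and their doubles\<close>

datatype hydra_gen = GenA nat | GenT

definition hydra_gens :: "nat \<Rightarrow> hydra_gen set" where
  "hydra_gens k = GenA ` {1..k} \<union> {GenT}"

text \<open>Conjugation is \<open>a\<^sup>b = b\<^sup>-\<^sup>1 a b\<close>.\<close>

definition hydra_rels :: "nat \<Rightarrow> (hydra_gen gword \<times> hydra_gen gword) set" where
  "hydra_rels k =
     {([(GenT, False), (GenA 1, True), (GenT, True)], [(GenA 1, True)])}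
   \<union> {([(GenT, False), (GenA i, True), (GenT, True)], [(GenA i, True), (GenA (i - 1), True)]) | i.
        1 < i \<and> i \<le> k}"

definition hydra :: "nat \<Rightarrow> hydra_gen gword set monoid" where
  "hydra k = presentation (hydra_gens k) (hydra_rels k)"

definition hydra_a :: "nat \<Rightarrow> nat \<Rightarrow> hydra_gen gword set" where
  "hydra_a k i = pres_class (hydra_gens k) (hydra_rels k) [(GenA i, True)]"

definition hydra_t :: "nat \<Rightarrow> hydra_gen gword set" where
  "hydra_t k = pres_class (hydra_gens k) (hydra_rels k) [(GenT, True)]"

definition hydra_at :: "nat \<Rightarrow> nat \<Rightarrow> hydra_gen gword set" where
  "hydra_at k i = hydra_a k i \<otimes>\<^bsub>hydra k\<^esub> hydra_t k"

definition hydra_H :: "nat \<Rightarrow> hydra_gen gword set set" where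
  "hydra_H k = generate (hydra k) (hydra_at k ` {1..k})"

text \<open>The two copies of \<open>hydra k\<close> are told apart by \<open>Inl\<close> and \<open>Inr\<close>, the latter giving the
  second copy.\<close>

definition hydra_double :: "nat \<Rightarrow> (hydra_gen gword set + hydra_gen gword set) gword set monoid" where
  "hydra_double k = amalgam (hydra k) (hydra k) {(hydra_at k i, hydra_at k i) | i. 1 \<le> i \<and> i \<le> k}"

text \<open>Identifying only the generators of \<open>hydra_H k\<close> with their copies is the same as
  amalgamating along the whole of \<open>hydra_H k\<close>.\<close>

lemma hydra_at_carrier:
  assumes "1 \<le> i" "i \<le> k"
  shows "hydra_at k i \<in> carrier (hydra k)"
proof -
  interpret group "hydra k" by (simp add: hydra_def group_presentation)
  show ?thesis
    using assms unfolding hydra_at_def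
    by (intro m_closed)
      (auto simp: hydra_a_def hydra_t_def hydra_def carrier_presentation hydra_gens_def)
qed

lemma pres_eq_mono_rels:
  assumes "pres_eq S R u v"
    and "\<And>u v. (u, v) \<in> R \<Longrightarrow> u \<in> gwords S \<Longrightarrow> v \<in> gwords S \<Longrightarrow> pres_eq S R' u v"
  shows "pres_eq S R' u v"
  using assms(1)
proof (induction rule: pres_eq.induct)
  case (refl w)
  then show ?case by (rule pres_eq.refl)
next
  case (sym u v)
  from sym.IH show ?case by (rule pres_eq.sym)
next
  case (trans u v w)
  from trans.IH show ?case by (rule pres_eq.trans)
next
  case (append u u' v v')
  from append.IH show ?case by (rule pres_eq.append)
next
  case (cancel x b)
  then show ?case by (rule pres_eq.cancel)
next
  case (rel u v)
  then show ?case by (rule assms(2))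
qed

lemma presentation_cong_rels:
  assumes "\<And>u v. (u, v) \<in> R \<Longrightarrow> u \<in> gwords S \<Longrightarrow> v \<in> gwords S \<Longrightarrow> pres_eq S R' u v"
    and "\<And>u v. (u, v) \<in> R' \<Longrightarrow> u \<in> gwords S \<Longrightarrow> v \<in> gwords S \<Longrightarrow> pres_eq S R u v"
  shows "presentation S R = presentation S R'"
proof -
  have "pres_eq S R = pres_eq S R'"
    using pres_eq_mono_rels [of S R _ _ R'] pres_eq_mono_rels [of S R' _ _ R] assms
    by (intro ext iffI) simp_all
  then show ?thesis
    by (simp add: presentation_def pres_class_def)
qed

lemma amalgam_hom_Inl:
  assumes "group G"
  shows "(\<lambda>g. pres_class (carrier G <+> carrier K) (amalgam_rels G K E) [(Inl g, True)])
    \<in> hom G (amalgam G K E)"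
proof (rule homI)
  interpret group G by fact
  fix x y assume "x \<in> carrier G" "y \<in> carrier G"
  then have "pres_eq (carrier G <+> carrier K) (amalgam_rels G K E)
       [(Inl (x \<otimes>\<^bsub>G\<^esub> y), True)] ([(Inl x, True)] @ [(Inl y, True)])"
    and "[(Inl x, True)] \<in> gwords (carrier G <+> carrier K)"
    and "[(Inl y, True)] \<in> gwords (carrier G <+> carrier K)"
    and "[(Inl (x \<otimes>\<^bsub>G\<^esub> y), True)] \<in> gwords (carrier G <+> carrier K)"
    by (auto simp: amalgam_rels_def intro!: pres_eq.sym [OF pres_eq.rel])
  then show "pres_class (carrier G <+> carrier K) (amalgam_rels G K E) [(Inl (x \<otimes>\<^bsub>G\<^esub> y), True)] =
     pres_class (carrier G <+> carrier K) (amalgam_rels G K E) [(Inl x, True)] \<otimes>\<^bsub>amalgam G K E\<^esub>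
     pres_class (carrier G <+> carrier K) (amalgam_rels G K E) [(Inl y, True)]"
    unfolding amalgam_def by (simp only: mult_presentation pres_class_eq_iff)
qed (auto simp: amalgam_def carrier_presentation)

lemma amalgam_hom_Inr:
  assumes "group K"
  shows "(\<lambda>g. pres_class (carrier G <+> carrier K) (amalgam_rels G K E) [(Inr g, True)])
    \<in> hom K (amalgam G K E)"
proof (rule homI)
  interpret group K by fact
  fix x y assume "x \<in> carrier K" "y \<in> carrier K"
  then have "pres_eq (carrier G <+> carrier K) (amalgam_rels G K E)
       [(Inr (x \<otimes>\<^bsub>K\<^esub> y), True)] ([(Inr x, True)] @ [(Inr y, True)])"
    and "[(Inr x, True)] \<in> gwords (carrier G <+> carrier K)"
    and "[(Inr y, True)] \<in> gwords (carrier G <+> carrier K)"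
    and "[(Inr (x \<otimes>\<^bsub>K\<^esub> y), True)] \<in> gwords (carrier G <+> carrier K)"
    by (auto simp: amalgam_rels_def intro!: pres_eq.sym [OF pres_eq.rel])
  then show "pres_class (carrier G <+> carrier K) (amalgam_rels G K E) [(Inr (x \<otimes>\<^bsub>K\<^esub> y), True)] =
     pres_class (carrier G <+> carrier K) (amalgam_rels G K E) [(Inr x, True)] \<otimes>\<^bsub>amalgam G K E\<^esub>
     pres_class (carrier G <+> carrier K) (amalgam_rels G K E) [(Inr y, True)]"
    unfolding amalgam_def by (simp only: mult_presentation pres_class_eq_iff)
qed (auto simp: amalgam_def carrier_presentation)

lemma group_amalgam: "group (amalgam G K E)"
  by (simp add: amalgam_def group_presentation)

lemma amalgam_generate:
  assumes "group G" and X: "X \<subseteq> carrier G"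
  shows "amalgam G G {(x, x) | x. x \<in> X} = amalgam G G {(h, h) | h. h \<in> generate G X}"
proof -
  interpret G: group G by fact
  define S where "S = carrier G <+> carrier G"
  define R where "R = amalgam_rels G G {(x, x) | x. x \<in> X}"
  define R' where "R' = amalgam_rels G G {(h, h) | h. h \<in> generate G X}"
  define P where "P = amalgam G G {(x, x) | x. x \<in> X}"
  define l where "l = (\<lambda>g. pres_class S R [(Inl g, True)])"
  define r where "r = (\<lambda>g. pres_class S R [(Inr g, True)])"
  have P: "group P"
    by (simp add: P_def group_amalgam)
  have l: "group_hom G P l"
    using amalgam_hom_Inl [OF \<open>group G\<close>] P \<open>group G\<close>
    by (auto simp: group_hom_def group_hom_axioms_def P_def l_def S_def R_def)
  have r: "group_hom G P r"
    using amalgam_hom_Inr [OF \<open>group G\<close>] P \<open>group G\<close>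
    by (auto simp: group_hom_def group_hom_axioms_def P_def r_def S_def R_def)
  interpret l: group_hom G P l by fact
  interpret r: group_hom G P r by fact
  have gen: "x \<in> carrier G \<and> l x = r x" if "x \<in> X" for x
  proof -
    have "pres_eq S R [(Inl x, True)] [(Inr x, True)]"
      using that X by (intro pres_eq.rel) (auto simp: R_def S_def amalgam_rels_def)
    then show ?thesis
      using that X pres_class_eq_iff [of "[(Inl x, True)]" S R "[(Inr x, True)]"]
      by (auto simp: l_def r_def S_def)
  qed
  have all: "h \<in> carrier G \<and> l h = r h" if "h \<in> generate G X" for h
    using that
  proof (induction rule: generate.induct)
    case one
    then show ?case using l.hom_one r.hom_one by simp
  next
    case (incl h)
    then show ?case using gen by simp
  next
    case (inv h)
    then show ?case using gen by simp
  next
    case (eng h1 h2)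
    then show ?case by simp
  qed
  have "presentation S R = presentation S R'"
  proof (rule presentation_cong_rels)
    fix u v assume "(u, v) \<in> R" "u \<in> gwords S" "v \<in> gwords S"
    moreover have "R \<subseteq> R'"
      unfolding R_def R'_def amalgam_rels_def using generate.incl [of _ X G] by blast
    ultimately show "pres_eq S R' u v"
      by (blast intro: pres_eq.rel)
  next
    fix u v assume uv: "(u, v) \<in> R'" "u \<in> gwords S" "v \<in> gwords S"
    show "pres_eq S R u v"
    proof (cases "(u, v) \<in> R")
      case True
      then show ?thesis using uv by (intro pres_eq.rel)
    next
      case False
      then obtain h where h: "h \<in> generate G X" "u = [(Inl h, True)]" "v = [(Inr h, True)]"
        using uv(1) unfolding R_def R'_def amalgam_rels_def by blast
      then have "pres_class S R u = pres_class S R v"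
        using all [OF h(1)] by (simp add: l_def r_def)
      then show ?thesis
        using pres_class_eq_iff [OF uv(2)] by blast
    qed
  qed
  then show ?thesis
    by (simp add: amalgam_def S_def R_def R'_def)
qed

lemma hydra_double_eq_amalgam:
  "hydra_double k = amalgam (hydra k) (hydra k) {(h, h) | h. h \<in> hydra_H k}"
proof -
  have "group (hydra k)"
    by (simp add: hydra_def group_presentation)
  moreover have "hydra_at k ` {1..k} \<subseteq> carrier (hydra k)"
    using hydra_at_carrier by auto
  ultimately have "amalgam (hydra k) (hydra k) {(x, x) | x. x \<in> hydra_at k ` {1..k}}
      = amalgam (hydra k) (hydra k) {(h, h) | h. h \<in> hydra_H k}"
    unfolding hydra_H_def by (rule amalgam_generate)
  moreover have "{(x, x) | x. x \<in> hydra_at k ` {1..k}} = {(hydra_at k i, hydra_at k i) | i. 1 \<le> i \<and> i \<le> k}"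
    unfolding image_def atLeastAtMost_iff Bex_def by blast
  ultimately show ?thesis
    unfolding hydra_double_def by (simp only:)
qed

end

theory Submission
  imports Defs "HOL-Algebra.Bij" "HOL-Algebra.Multiplicative_Group" "HOL-Combinatorics.Transposition" "HOL-Library.Countable_Set"
begin

text \<open>Write \<open>x\<^sub>i = a\<^sub>i t\<close>. Then \<open>x\<^sub>1\<close> commutes with \<open>t\<close>, and \<open>x\<^sub>i\<^sub>+\<^sub>1\<close> conjugates \<open>t\<close> to
  \<open>t x\<^sub>i\<^sup>-\<^sup>1 t\<close>. Let \<open>w = t x\<^sub>2\<^sup>-\<^sup>1 x\<^sub>1 x\<^sub>2 t\<^sup>-\<^sup>1\<close>. Two homomorphisms to a finite group that agree on all
  \<open>x\<^sub>i\<close> also agree at \<open>w\<close>: if \<open>G\<^sub>k\<close> acts from the right on a finite set and all \<open>x\<^sub>i\<close> fix a point \<open>p\<close>,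
  then \<open>x\<^sub>1\<close> fixes the \<open>t\<close>-orbit \<open>\<int>/n\<close> of \<open>p\<close> pointwise and \<open>x\<^sub>2\<close> acts on it as multiplication by \<open>2\<close>,
  so \<open>n\<close> is odd, \<open>p t x\<^sub>2\<^sup>-\<^sup>1\<close> lies in this orbit, and \<open>w\<close> fixes \<open>p\<close>. On an infinite set, however,
  \<open>x\<^sub>2\<^sup>-\<^sup>1\<close> can map \<open>p t\<close> to a new \<open>t\<close>-orbit, where \<open>x\<^sub>1\<close> acts nontrivially. The permutations
  \<open>x\<^sub>2, x\<^sub>3, \<dots>, x\<^sub>k\<close> are adjoined one at a time. So \<open>w\<close> and its copy differ in the
  double, but not in its finite quotients.\<close>

section \<open>Homomorphisms out of presented groups\<close>

definition letter_val :: "('b, 'm) monoid_scheme \<Rightarrow> ('a \<Rightarrow> 'b) \<Rightarrow> 'a \<times> bool \<Rightarrow> 'b" where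
  "letter_val L f l = (if snd l then f (fst l) else inv\<^bsub>L\<^esub> (f (fst l)))"

definition word_val :: "('b, 'm) monoid_scheme \<Rightarrow> ('a \<Rightarrow> 'b) \<Rightarrow> 'a gword \<Rightarrow> 'b" where
  "word_val L f w = foldr (\<lambda>l z. letter_val L f l \<otimes>\<^bsub>L\<^esub> z) w \<one>\<^bsub>L\<^esub>"

lemma word_val_simps [simp]:
  "word_val L f [] = \<one>\<^bsub>L\<^esub>"
  "word_val L f (l # w) = letter_val L f l \<otimes>\<^bsub>L\<^esub> word_val L f w"
  by (simp_all add: word_val_def)

lemma letter_val_simps [simp]:
  "letter_val L f (x, True) = f x"
  "letter_val L f (x, False) = inv\<^bsub>L\<^esub> (f x)"
  by (simp_all add: letter_val_def)

context group
begin

lemma letter_val_closed: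
  assumes "f \<in> S \<rightarrow> carrier G" "fst l \<in> S"
  shows "letter_val G f l \<in> carrier G"
  using assms by (auto simp: letter_val_def)

lemma word_val_closed:
  assumes "f \<in> S \<rightarrow> carrier G" "w \<in> gwords S"
  shows "word_val G f w \<in> carrier G"
  using assms(2)
  by (induction w)
    (auto simp del: in_lists_conv_set intro!: m_closed letter_val_closed [OF assms(1)])

lemma word_val_append:
  assumes "f \<in> S \<rightarrow> carrier G" "u \<in> gwords S" "v \<in> gwords S"
  shows "word_val G f (u @ v) = word_val G f u \<otimes> word_val G f v"
  using assms(2)
proof (induction u)
  case (Cons l u)
  then have "letter_val G f l \<in> carrier G"
    by (auto intro: letter_val_closed [OF assms(1)])
  with Cons assms show ?case
    by (auto simp: m_assoc word_val_closed)
qed (use assms in \<open>simp add: word_val_closed\<close>)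

lemma word_val_cong:
  assumes f: "f \<in> S \<rightarrow> carrier G"
    and rels: "\<And>u v. (u, v) \<in> R \<Longrightarrow> u \<in> gwords S \<Longrightarrow> v \<in> gwords S
        \<Longrightarrow> word_val G f u = word_val G f v"
    and "pres_eq S R u v"
  shows "word_val G f u = word_val G f v"
  using assms(3)
proof (induction rule: pres_eq.induct)
  case (append u u' v v')
  then show ?case
    using pres_eq_gwords [OF append.hyps(1)] pres_eq_gwords [OF append.hyps(2)]
    by (simp add: word_val_append [OF f])
next
  case (cancel x b)
  then have "f x \<in> carrier G"
    using f by auto
  then show ?case
    by (cases b) simp_all
qed (use rels in auto)

text \<open>Von Dyck's theorem. By \<open>word_val_cong\<close> the value of a class does not depend
  on the representative that \<open>SOME\<close> picks.\<close>

lemma presentation_lift: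
  assumes f: "f \<in> S \<rightarrow> carrier G"
    and rels: "\<And>u v. (u, v) \<in> R \<Longrightarrow> u \<in> gwords S \<Longrightarrow> v \<in> gwords S
        \<Longrightarrow> word_val G f u = word_val G f v"
  obtains h where "h \<in> hom (presentation S R) G"
    and "\<And>x. x \<in> S \<Longrightarrow> h (pres_class S R [(x, True)]) = f x"
proof -
  define h where "h U = word_val G f (SOME u. u \<in> U)" for U
  have h: "h (pres_class S R w) = word_val G f w" if "w \<in> gwords S" for w
  proof -
    have "w \<in> pres_class S R w"
      using that by (simp add: pres_class_def pres_eq.refl)
    then have "(SOME u. u \<in> pres_class S R w) \<in> pres_class S R w"
      by (rule someI)
    then show ?thesis
      using word_val_cong [OF f rels] by (auto simp: h_def pres_class_def)
  qed
  have "h \<in> hom (presentation S R) G"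
  proof (rule homI)
    fix U V
    assume "U \<in> carrier (presentation S R)" "V \<in> carrier (presentation S R)"
    then obtain u v where u: "u \<in> gwords S" "U = pres_class S R u"
      and v: "v \<in> gwords S" "V = pres_class S R v"
      unfolding carrier_presentation by (elim imageE) metis
    have "u @ v \<in> gwords S"
      using u v by simp
    then show "h (U \<otimes>\<^bsub>presentation S R\<^esub> V) = h U \<otimes> h V"
      using u v by (simp only: h mult_presentation word_val_append [OF f])
  next
    fix U
    assume "U \<in> carrier (presentation S R)"
    then show "h U \<in> carrier G"
      unfolding carrier_presentation by (elim imageE) (simp only: h word_val_closed [OF f])
  qed
  moreover have "h (pres_class S R [(x, True)]) = f x" if "x \<in> S" for x
    using that funcset_mem [OF f that] h [of "[(x, True)]"] by simp
  ultimately show ?thesis ..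
qed

end

section \<open>Universal property of the amalgam\<close>

definition amalgam_inl where
  "amalgam_inl G K E g = pres_class (carrier G <+> carrier K) (amalgam_rels G K E) [(Inl g, True)]"

definition amalgam_inr where
  "amalgam_inr G K E g = pres_class (carrier G <+> carrier K) (amalgam_rels G K E) [(Inr g, True)]"

lemma amalgam_inl_hom: "group G \<Longrightarrow> amalgam_inl G K E \<in> hom G (amalgam G K E)"
  unfolding amalgam_inl_def using amalgam_hom_Inl by blast

lemma amalgam_inr_hom: "group K \<Longrightarrow> amalgam_inr G K E \<in> hom K (amalgam G K E)"
  unfolding amalgam_inr_def using amalgam_hom_Inr by blast

lemma amalgam_inl_eq_inr:
  assumes "(x, y) \<in> E" "x \<in> carrier G" "y \<in> carrier K"
  shows "amalgam_inl G K E x = amalgam_inr G K E y"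
proof -
  have "pres_eq (carrier G <+> carrier K) (amalgam_rels G K E) [(Inl x, True)] [(Inr y, True)]"
    using assms by (intro pres_eq.rel) (auto simp: amalgam_rels_def)
  then show ?thesis
    unfolding amalgam_inl_def amalgam_inr_def
    using pres_eq_gwords by (subst pres_class_eq_iff) blast+
qed

lemma (in group) amalgam_lift:
  assumes f: "f \<in> hom K G" and g: "g \<in> hom M G"
    and eq: "\<And>x y. (x, y) \<in> E \<Longrightarrow> x \<in> carrier K \<Longrightarrow> y \<in> carrier M \<Longrightarrow> f x = g y"
  obtains h where "h \<in> hom (amalgam K M E) G"
    and "\<And>x. x \<in> carrier K \<Longrightarrow> h (amalgam_inl K M E x) = f x"
    and "\<And>y. y \<in> carrier M \<Longrightarrow> h (amalgam_inr K M E y) = g y"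
proof -
  have F: "case_sum f g \<in> (carrier K <+> carrier M) \<rightarrow> carrier G"
    using f g by (auto simp: hom_def)
  have "word_val G (case_sum f g) u = word_val G (case_sum f g) v"
    if "(u, v) \<in> amalgam_rels K M E" "u \<in> gwords (carrier K <+> carrier M)"
       "v \<in> gwords (carrier K <+> carrier M)" for u v
    using that f g by (auto simp: amalgam_rels_def eq hom_in_carrier hom_mult)
  from presentation_lift [OF F this] obtain h where
    "h \<in> hom (presentation (carrier K <+> carrier M) (amalgam_rels K M E)) G"
    "\<And>x. x \<in> carrier K <+> carrier M \<Longrightarrow>
       h (pres_class (carrier K <+> carrier M) (amalgam_rels K M E) [(x, True)]) = case_sum f g x"
    by blast
  then show ?thesis
    by (intro that [of h]) (simp_all add: amalgam_def amalgam_inl_def amalgam_inr_def InlI InrI)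
qed

section \<open>Hydra groups in the generators \<open>hydra_at k i\<close>\<close>

lemma group_hydra: "group (hydra k)"
  by (simp add: hydra_def group_presentation)

lemma hydra_t_carrier [simp]: "hydra_t k \<in> carrier (hydra k)"
  by (auto simp: hydra_t_def hydra_def carrier_presentation hydra_gens_def)

lemma hydra_a_carrier: "1 \<le> i \<Longrightarrow> i \<le> k \<Longrightarrow> hydra_a k i \<in> carrier (hydra k)"
  by (auto simp: hydra_a_def hydra_def carrier_presentation hydra_gens_def)

lemma hydra_a_comm:
  assumes "1 \<le> k"
  shows "hydra_a k 1 \<otimes>\<^bsub>hydra k\<^esub> hydra_t k = hydra_t k \<otimes>\<^bsub>hydra k\<^esub> hydra_a k 1"
proof -
  interpret group "hydra k" by (rule group_hydra)
  let ?S = "hydra_gens k" and ?R = "hydra_rels k"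
  let ?w = "[(GenT, False), (GenA 1, True), (GenT, True)]"
  have mem: "GenT \<in> ?S" "GenA 1 \<in> ?S"
    using assms by (auto simp: hydra_gens_def)
  have "pres_eq ?S ?R ([(GenT, True)] @ ?w) ([(GenT, True)] @ [(GenA 1, True)])"
    using mem by (intro pres_eq.append pres_eq.refl pres_eq.rel) (auto simp: hydra_rels_def)
  moreover have "pres_eq ?S ?R ([(GenT, True), (GenT, \<not> True)] @ [(GenA 1, True), (GenT, True)])
      ([] @ [(GenA 1, True), (GenT, True)])"
    using mem by (intro pres_eq.append pres_eq.refl pres_eq.cancel) auto
  ultimately have "pres_eq ?S ?R ([(GenA 1, True)] @ [(GenT, True)]) ([(GenT, True)] @ [(GenA 1, True)])"
    by (auto intro: pres_eq.sym pres_eq.trans)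
  then show ?thesis
    using mem by (simp add: hydra_a_def hydra_t_def hydra_def mult_presentation pres_class_eq_iff)
qed

lemma hydra_a_rel:
  assumes "1 < i" "i \<le> k"
  shows "hydra_a k i \<otimes>\<^bsub>hydra k\<^esub> hydra_t k =
    hydra_t k \<otimes>\<^bsub>hydra k\<^esub> (hydra_a k i \<otimes>\<^bsub>hydra k\<^esub> hydra_a k (i - 1))"
proof -
  interpret group "hydra k" by (rule group_hydra)
  let ?S = "hydra_gens k" and ?R = "hydra_rels k"
  let ?w = "[(GenT, False), (GenA i, True), (GenT, True)]"
  have "i - 1 \<in> {1..k}"
    using assms by auto
  then have mem: "GenT \<in> ?S" "GenA i \<in> ?S" "GenA (i - 1) \<in> ?S"
    using assms unfolding hydra_gens_def by auto
  have "pres_eq ?S ?R ([(GenT, True)] @ ?w)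
      ([(GenT, True)] @ [(GenA i, True), (GenA (i - 1), True)])"
    using mem assms by (intro pres_eq.append pres_eq.refl pres_eq.rel) (auto simp: hydra_rels_def)
  moreover have "pres_eq ?S ?R ([(GenT, True), (GenT, \<not> True)] @ [(GenA i, True), (GenT, True)])
      ([] @ [(GenA i, True), (GenT, True)])"
    using mem by (intro pres_eq.append pres_eq.refl pres_eq.cancel) auto
  ultimately have "pres_eq ?S ?R ([(GenA i, True)] @ [(GenT, True)])
      ([(GenT, True)] @ ([(GenA i, True)] @ [(GenA (i - 1), True)]))"
    by (auto intro: pres_eq.sym pres_eq.trans)
  then show ?thesis
    using mem by (simp add: hydra_a_def hydra_t_def hydra_def mult_presentation pres_class_eq_iff)
qed

lemma hydra_at_comm:
  assumes "1 \<le> k"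
  shows "inv\<^bsub>hydra k\<^esub> hydra_t k \<otimes>\<^bsub>hydra k\<^esub> hydra_at k 1 =
    hydra_at k 1 \<otimes>\<^bsub>hydra k\<^esub> inv\<^bsub>hydra k\<^esub> hydra_t k"
proof -
  interpret group "hydra k" by (rule group_hydra)
  have a: "hydra_a k 1 \<in> carrier (hydra k)"
    using assms by (simp add: hydra_a_carrier)
  show ?thesis
    unfolding hydra_at_def using a hydra_a_comm [OF assms]
    by (metis hydra_t_carrier inv_closed inv_solve_left inv_solve_right' m_assoc m_closed)
qed

text \<open>Both sides are \<open>a_i a_(i-1)\<close>: the left one is \<open>t^-1 a_i t\<close>,
  and on the right \<open>hydra_at k i\<close> times \<open>t^-1\<close> is
  \<open>a_i\<close>.\<close>

lemma hydra_at_rel: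
  assumes "1 < i" "i \<le> k"
  shows "inv\<^bsub>hydra k\<^esub> hydra_t k \<otimes>\<^bsub>hydra k\<^esub> hydra_at k i =
    hydra_at k i \<otimes>\<^bsub>hydra k\<^esub> (inv\<^bsub>hydra k\<^esub> hydra_t k \<otimes>\<^bsub>hydra k\<^esub>
      (hydra_at k (i - 1) \<otimes>\<^bsub>hydra k\<^esub> inv\<^bsub>hydra k\<^esub> hydra_t k))"
proof -
  interpret group "hydra k" by (rule group_hydra)
  have a: "hydra_a k i \<in> carrier (hydra k)" "hydra_a k (i - 1) \<in> carrier (hydra k)"
    using assms by (simp_all add: hydra_a_carrier)
  have "inv\<^bsub>hydra k\<^esub> hydra_t k \<otimes>\<^bsub>hydra k\<^esub> hydra_at k i = hydra_a k i \<otimes>\<^bsub>hydra k\<^esub> hydra_a k (i - 1)"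
    unfolding hydra_at_def using a hydra_a_rel [OF assms]
    by (metis hydra_t_carrier inv_solve_left m_closed)
  also have "\<dots> = hydra_at k i \<otimes>\<^bsub>hydra k\<^esub> (inv\<^bsub>hydra k\<^esub> hydra_t k \<otimes>\<^bsub>hydra k\<^esub>
      (hydra_at k (i - 1) \<otimes>\<^bsub>hydra k\<^esub> inv\<^bsub>hydra k\<^esub> hydra_t k))"
    unfolding hydra_at_def using a
    by (simp add: m_assoc inv_solve_left r_inv m_assoc [symmetric])
  finally show ?thesis .
qed

text \<open>Universal property in the generators \<open>t^-1\<close> and
  \<open>hydra_at k i\<close>. Sending \<open>t\<close> to \<open>s^-1\<close> and
  \<open>a_i\<close> to \<open>y_i s\<close> takes \<open>t^-1 a_i t\<close> to
  \<open>s y_i\<close>, so the defining relations turn into \<open>y1\<close> and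
  \<open>yi\<close>.\<close>

lemma (in group) hydra_lift:
  assumes s: "s \<in> carrier G" and y: "\<And>i. 1 \<le> i \<Longrightarrow> i \<le> k \<Longrightarrow> y i \<in> carrier G"
    and "1 \<le> k"
    and y1: "s \<otimes> y 1 = y 1 \<otimes> s"
    and yi: "\<And>i. 1 < i \<Longrightarrow> i \<le> k \<Longrightarrow> s \<otimes> y i = y i \<otimes> (s \<otimes> (y (i - 1) \<otimes> s))"
  obtains h where "h \<in> hom (hydra k) G" "h (hydra_t k) = inv s"
    "\<And>i. 1 \<le> i \<Longrightarrow> i \<le> k \<Longrightarrow> h (hydra_at k i) = y i"
proof -
  define f where "f = (\<lambda>x. case x of GenA i \<Rightarrow> y i \<otimes> s | GenT \<Rightarrow> inv s)"
  have f: "f \<in> hydra_gens k \<rightarrow> carrier G"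
    using s y by (auto simp: hydra_gens_def f_def)
  have "word_val G f u = word_val G f v"
    if uv: "(u, v) \<in> hydra_rels k" "u \<in> gwords (hydra_gens k)" "v \<in> gwords (hydra_gens k)" for u v
  proof -
    have "s \<otimes> (y 1 \<otimes> (s \<otimes> inv s)) = y 1 \<otimes> s"
      using s y [of 1] \<open>1 \<le> k\<close> y1 by simp
    moreover have "s \<otimes> (y i \<otimes> (s \<otimes> inv s)) = y i \<otimes> (s \<otimes> (y (i - 1) \<otimes> s))"
      if "1 < i" "i \<le> k" for i
      using s y [of i] yi that by simp
    ultimately show ?thesis
      using uv(1) s y \<open>1 \<le> k\<close>
      by (auto simp: hydra_rels_def f_def m_assoc)
  qed
  from presentation_lift [OF f this] obtain h where
    h: "h \<in> hom (hydra k) G"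
    "\<And>x. x \<in> hydra_gens k \<Longrightarrow> h (pres_class (hydra_gens k) (hydra_rels k) [(x, True)]) = f x"
    by (metis hydra_def)
  have t: "h (hydra_t k) = inv s"
    using h(2) [of GenT] by (simp add: hydra_t_def hydra_gens_def f_def)
  have a: "h (hydra_a k i) = y i \<otimes> s" if "1 \<le> i" "i \<le> k" for i
    using h(2) [of "GenA i"] that by (simp add: hydra_a_def hydra_gens_def f_def)
  have "h (hydra_at k i) = y i" if "1 \<le> i" "i \<le> k" for i
    unfolding hydra_at_def using that s y
    by (simp add: hom_mult [OF h(1)] hydra_a_carrier t a m_assoc)
  with h(1) t show ?thesis
    by (rule that)
qed

text \<open>Since \<open>hydra_at k 2\<close> times \<open>t^-1\<close> is \<open>a_2\<close>, this
  is the conjugate of \<open>hydra_at k 1\<close> by \<open>a_2\<close>.\<close>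

definition hydra_witness :: "nat \<Rightarrow> hydra_gen gword set" where
  "hydra_witness k = hydra_t k \<otimes>\<^bsub>hydra k\<^esub> (inv\<^bsub>hydra k\<^esub> hydra_at k 2 \<otimes>\<^bsub>hydra k\<^esub>
     (hydra_at k 1 \<otimes>\<^bsub>hydra k\<^esub> (hydra_at k 2 \<otimes>\<^bsub>hydra k\<^esub> inv\<^bsub>hydra k\<^esub> hydra_t k)))"

lemma hydra_witness_carrier:
  assumes "k > 1"
  shows "hydra_witness k \<in> carrier (hydra k)"
proof -
  interpret group "hydra k" by (rule group_hydra)
  show ?thesis
    using assms by (simp add: hydra_witness_def hydra_at_carrier)
qed

section \<open>Homomorphisms into finite groups\<close>

text \<open>Conjugation by \<open>Y\<close> takes \<open>A\<close> to \<open>A X A = A^2 X\<close>;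
  as \<open>A\<close> and \<open>X\<close> commute, the \<open>m\<close>-th power of this is
  \<open>A^(2m) X^m\<close>.\<close>

lemma (in group) pow_twisted:
  assumes carr: "A \<in> carrier G" "X \<in> carrier G" "Y \<in> carrier G"
    and AX: "A \<otimes> X = X \<otimes> A" and AY: "A \<otimes> Y = Y \<otimes> (A \<otimes> (X \<otimes> A))"
  shows "A [^] (m::nat) \<otimes> Y = Y \<otimes> (A [^] (2 * m) \<otimes> X [^] m)"
proof (induction m)
  case (Suc m)
  have comm: "X [^] m \<otimes> A = A \<otimes> X [^] m"
    using carr AX by (simp add: group_commutes_pow)
  have "A [^] Suc m \<otimes> Y = A [^] m \<otimes> Y \<otimes> (A \<otimes> A \<otimes> X)"
    using carr AX AY by (simp add: m_assoc)
  also have "\<dots> = Y \<otimes> (A [^] (2 * m) \<otimes> (X [^] m \<otimes> A \<otimes> A \<otimes> X))"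
    using carr by (simp add: Suc.IH m_assoc)
  also have "X [^] m \<otimes> A \<otimes> A \<otimes> X = A \<otimes> A \<otimes> X [^] Suc m"
    using carr comm by (metis m_assoc m_closed nat_pow_Suc nat_pow_closed)
  also have "Y \<otimes> (A [^] (2 * m) \<otimes> (A \<otimes> A \<otimes> X [^] Suc m)) = Y \<otimes> (A [^] (2 * Suc m) \<otimes> X [^] Suc m)"
    using carr by (simp add: m_assoc)
  finally show ?case .
qed (use carr in simp)

text \<open>The least \<open>n > 0\<close> with \<open>A\<^sup>n = B\<^sup>n\<close> is odd, because \<open>A\<^sup>m = B\<^sup>m\<close> as soon as \<open>A\<^sup>2\<^sup>m = B\<^sup>2\<^sup>m\<close>.
  So \<open>B A\<^sup>-\<^sup>1 = B\<^sup>2\<^sup>m A\<^sup>-\<^sup>2\<^sup>m\<close> with \<open>2m = n + 1\<close>, and conjugation by \<open>Y\<close> turns this element into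
  \<open>B\<^sup>m A\<^sup>-\<^sup>m\<close>, which commutes with \<open>X\<close>.\<close>

lemma (in group) finite_twisted_eq:
  assumes fin: "finite (carrier G)"
    and carr: "A \<in> carrier G" "B \<in> carrier G" "X \<in> carrier G" "Y \<in> carrier G"
    and AX: "A \<otimes> X = X \<otimes> A" and AY: "A \<otimes> Y = Y \<otimes> (A \<otimes> (X \<otimes> A))"
    and BX: "B \<otimes> X = X \<otimes> B" and BY: "B \<otimes> Y = Y \<otimes> (B \<otimes> (X \<otimes> B))"
  shows "inv A \<otimes> (inv Y \<otimes> (X \<otimes> (Y \<otimes> A))) = inv B \<otimes> (inv Y \<otimes> (X \<otimes> (Y \<otimes> B)))"
proof -
  note pA = pow_twisted [OF carr(1,3,4) AX AY]
  note pB = pow_twisted [OF carr(2,3,4) BX BY]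
  have half: "A [^] m = B [^] m" if "A [^] (2 * m) = B [^] (2 * m)" for m :: nat
    using pA [of m] pB [of m] that carr by (metis nat_pow_closed right_cancel)
  define n where "n = (LEAST n::nat. n > 0 \<and> A [^] n = B [^] n)"
  \<comment> \<open>Finiteness enters only here: it yields a positive \<open>n\<close> with
    \<open>A^n = B^n\<close>.\<close>
  have "order G > 0 \<and> A [^] order G = B [^] order G"
    using fin carr by (simp add: pow_order_eq_1 order_gt_0_iff_finite)
  then have n: "n > 0" "A [^] n = B [^] n" and least: "\<And>m. m > 0 \<Longrightarrow> A [^] m = B [^] m \<Longrightarrow> n \<le> m"
    unfolding n_def using LeastI_ex [of "\<lambda>n. n > 0 \<and> A [^] n = B [^] n"]
    by (auto intro: Least_le)
  have "odd n"
  proof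
    assume "even n"
    then obtain m where m: "n = 2 * m" by blast
    with n half [of m] have "m > 0" "A [^] m = B [^] m" by auto
    then show False using least [of m] m by simp
  qed
  then obtain m where m: "2 * m = Suc n"
    by (metis even_Suc evenE)
  define a where "a = A [^] m"
  define b where "b = B [^] m"
  define c where "c = A [^] n"
  define x where "x = X [^] m"
  have carr': "a \<in> carrier G" "b \<in> carrier G" "c \<in> carrier G" "x \<in> carrier G"
    using carr by (simp_all add: a_def b_def c_def x_def)
  have "A [^] (2 * m) = A \<otimes> c"
    using carr by (metis m c_def nat_pow_Suc2)
  then have a: "a \<otimes> Y = Y \<otimes> (A \<otimes> (c \<otimes> x))"
    using pA [of m] carr carr' by (simp add: a_def x_def m_assoc)
  have "B [^] (2 * m) = B \<otimes> c"
    using carr n(2) by (metis m c_def nat_pow_Suc2)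
  then have b: "b \<otimes> Y = Y \<otimes> (B \<otimes> (c \<otimes> x))"
    using pB [of m] carr carr' by (simp add: b_def x_def m_assoc)
  \<comment> \<open>Because \<open>c\<close> is both \<open>A^n\<close> and \<open>B^n\<close>, the
    same \<open>d\<close> gives \<open>Y A = a d^-1\<close> and \<open>Y B = b d^-1\<close>. As
    \<open>a\<close> and \<open>b\<close> commute with \<open>X\<close>, both sides of the claim
    become \<open>d X d^-1\<close>.\<close>
  define d where "d = c \<otimes> x \<otimes> inv Y"
  have d: "d \<in> carrier G" using carr carr' by (simp add: d_def)
  have solve: "Y \<otimes> Z = z \<otimes> inv d"
    if "Z \<in> carrier G" "z \<in> carrier G" "z \<otimes> Y = Y \<otimes> (Z \<otimes> (c \<otimes> x))" for Z z
  proof -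
    have "z = z \<otimes> Y \<otimes> inv Y"
      using that(2) carr by (simp add: m_assoc)
    also have "\<dots> = Y \<otimes> Z \<otimes> d"
      unfolding that(3) using that(1) carr carr' by (simp add: d_def m_assoc)
    finally show ?thesis
      using that(1,2) carr(4) d by (subst inv_solve_right) simp_all
  qed
  note a' = solve [OF carr(1) carr'(1) a] and b' = solve [OF carr(2) carr'(2) b]
  have ax: "a \<otimes> X = X \<otimes> a" and bx: "b \<otimes> X = X \<otimes> b"
    using carr AX BX by (simp_all add: a_def b_def group_commutes_pow)
  have "inv Z \<otimes> (inv Y \<otimes> (X \<otimes> (Y \<otimes> Z))) = d \<otimes> (X \<otimes> inv d)"
    if Z: "Z \<in> carrier G" "Y \<otimes> Z = z \<otimes> inv d" "z \<in> carrier G" "z \<otimes> X = X \<otimes> z" for Z z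
  proof -
    have "inv Z \<otimes> (inv Y \<otimes> (X \<otimes> (Y \<otimes> Z))) = inv (Y \<otimes> Z) \<otimes> (X \<otimes> (Y \<otimes> Z))"
      using Z(1) carr by (simp add: inv_mult_group m_assoc)
    also have "\<dots> = d \<otimes> (inv z \<otimes> (X \<otimes> z) \<otimes> inv d)"
      unfolding Z(2) using Z(3) carr d by (simp add: inv_mult_group m_assoc)
    also have "inv z \<otimes> (X \<otimes> z) = X"
      using Z carr by (metis inv_solve_left m_closed)
    finally show ?thesis .
  qed
  from this [OF carr(1) a' carr'(1) ax] this [OF carr(2) b' carr'(2) bx] show ?thesis
    by simp
qed

section \<open>Permutations satisfying the hydra relations\<close>

abbreviation finv :: "('a \<Rightarrow> 'b) \<Rightarrow> 'b \<Rightarrow> 'a" where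
  "finv \<equiv> inv_into UNIV"

definition zpow :: "('a \<Rightarrow> 'a) \<Rightarrow> int \<Rightarrow> 'a \<Rightarrow> 'a" where
  "zpow f n = (if 0 \<le> n then f ^^ nat n else finv f ^^ nat (- n))"

lemma zpow_0 [simp]: "zpow f 0 x = x"
  by (simp add: zpow_def)

lemma zpow_of_nat [simp]: "zpow f (int n) = f ^^ n"
  by (simp add: zpow_def)

lemma zpow_step:
  assumes "bij f"
  shows "f (zpow f n x) = zpow f (n + 1) x"
proof (cases "n < 0")
  case True
  then have "nat (- n) = Suc (nat (- n - 1))" by simp
  then have "zpow f n x = finv f ((finv f ^^ nat (- n - 1)) x)"
    using True by (simp add: zpow_def)
  then have "f (zpow f n x) = (finv f ^^ nat (- n - 1)) x"
    using assms by (simp add: bij_is_surj surj_f_inv_f)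
  with True show ?thesis
    by (auto simp: zpow_def)
next
  case False
  then show ?thesis by (simp add: zpow_def nat_add_distrib)
qed

lemma zpow_inv_step:
  assumes "bij f"
  shows "finv f (zpow f n x) = zpow f (n - 1) x"
  using zpow_step [OF assms, of "n - 1" x] assms by (metis bij_inv_eq_iff diff_add_cancel)

lemma zpow_add:
  assumes "bij f"
  shows "zpow f m (zpow f n x) = zpow f (m + n) x"
proof (induction m rule: int_induct [where k = 0])
  case (step1 m)
  then show ?case
    using zpow_step [OF assms] by (metis add.commute add.left_commute)
next
  case (step2 m)
  then show ?case
    using zpow_inv_step [OF assms] by (metis add_diff_eq add.commute)
qed simp

lemma zpow_orbit_inj:
  assumes f: "bij f" and aper: "\<And>n. n > 0 \<Longrightarrow> (f ^^ n) p \<noteq> p"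
  shows "inj (\<lambda>n. zpow f n p)"
proof -
  have "\<not> i < j" if "zpow f i p = zpow f j p" for i j
  proof
    assume "i < j"
    have "zpow f (- i + j) p = p"
      using that zpow_add [OF f, of "- i" i p] zpow_add [OF f, of "- i" j p] by simp
    moreover have "zpow f (- i + j) p \<noteq> p"
      using aper [of "nat (j - i)"] \<open>i < j\<close> by (simp add: zpow_def)
    ultimately show False by contradiction
  qed
  then show ?thesis
    by (metis injI linorder_neqE)
qed

text \<open>\<open>T\<close> and \<open>Y i\<close> are the left actions of \<open>t\<^sup>-\<^sup>1\<close> and \<open>a\<^sub>i t\<close>. In these generators the relation
  \<open>a\<^sub>i\<^sup>t = a\<^sub>i a\<^sub>i\<^sub>-\<^sub>1\<close> says that \<open>Y i\<close> conjugates \<open>T \<circ> Y (i - 1) \<circ> T\<close> to \<open>T\<close>. The last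
  condition keeps the point \<open>p\<close>, which all \<open>Y i\<close> fix, on infinite cycles of these two
  permutations, also for the next step \<open>i = k + 1\<close>.\<close>

locale hydra_perms =
  fixes k :: nat and T :: "'a \<Rightarrow> 'a" and Y :: "nat \<Rightarrow> 'a \<Rightarrow> 'a" and p :: 'a
  assumes k: "1 \<le> k"
    and bij_T: "bij T"
    and bij_Y: "\<And>i. 1 \<le> i \<Longrightarrow> i \<le> k \<Longrightarrow> bij (Y i)"
    and fixp: "\<And>i. 1 \<le> i \<Longrightarrow> i \<le> k \<Longrightarrow> Y i p = p"
    and comm: "T (Y 1 s) = Y 1 (T s)"
    and conj: "\<And>i. 1 < i \<Longrightarrow> i \<le> k \<Longrightarrow> T (Y i s) = Y i (T (Y (i - 1) (T s)))"
    and pos: "\<And>m n. 0 < m + n \<Longrightarrow> ((T \<circ> Y k \<circ> T) ^^ m) ((T ^^ n) p) \<noteq> p"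
begin

section \<open>One extension step, from \<open>k\<close> to \<open>Suc k\<close>
  permutations\<close>

definition U :: "'a \<Rightarrow> 'a" where "U = T \<circ> Y k \<circ> T"

definition orbT :: "'a set" where "orbT = range (\<lambda>n. zpow T n p)"

definition orbU :: "'a set" where "orbU = range (\<lambda>n. zpow U n p)"

text \<open>The bijection from \<open>orbU\<close> to \<open>orbT\<close> that fixes
  \<open>p\<close> and turns \<open>U\<close> into \<open>T\<close>. The exponent is well defined on
  \<open>orbU\<close> by \<open>inj_U\<close>.\<close>

definition UtoT :: "'a \<Rightarrow> 'a" where "UtoT s = zpow T (the_inv (\<lambda>n. zpow U n p) s) p"

definition TtoU :: "'a \<Rightarrow> 'a" where "TtoU s = zpow U (the_inv (\<lambda>n. zpow T n p) s) p"

lemma bij_U: "bij U"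
  unfolding U_def using bij_T bij_Y k by (simp add: bij_comp)

lemma inj_T: "inj (\<lambda>n. zpow T n p)"
  using pos [of 0] by (intro zpow_orbit_inj bij_T) auto

lemma inj_U: "inj (\<lambda>n. zpow U n p)"
  using pos [of _ 0] by (intro zpow_orbit_inj bij_U) (auto simp: U_def)

lemma UtoT: "UtoT (zpow U n p) = zpow T n p"
  by (simp add: UtoT_def the_inv_f_f [OF inj_U])

lemma TtoU: "TtoU (zpow T n p) = zpow U n p"
  by (simp add: TtoU_def the_inv_f_f [OF inj_T])

lemma orb_maps:
  "s \<in> orbU \<Longrightarrow> UtoT s \<in> orbT" "s \<in> orbU \<Longrightarrow> TtoU (UtoT s) = s"
  "s \<in> orbT \<Longrightarrow> TtoU s \<in> orbU" "s \<in> orbT \<Longrightarrow> UtoT (TtoU s) = s"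
  "s \<in> orbU \<Longrightarrow> UtoT (U s) = T (UtoT s)"
  by (auto simp: orbU_def orbT_def UtoT TtoU zpow_step bij_T bij_U)

lemma orb_step: "U s \<in> orbU \<longleftrightarrow> s \<in> orbU" "T s \<in> orbT \<longleftrightarrow> s \<in> orbT"
proof -
  have "f s \<in> range (\<lambda>n. zpow f n p) \<longleftrightarrow> s \<in> range (\<lambda>n. zpow f n p)" if "bij f" for f
  proof
    assume "f s \<in> range (\<lambda>n. zpow f n p)"
    then obtain n where "f s = zpow f n p" by blast
    then have "s = zpow f (n - 1) p"
      using zpow_inv_step [OF that, of n p] bij_is_inj [OF that] by (metis inv_f_f)
    then show "s \<in> range (\<lambda>n. zpow f n p)" by blast
  next
    assume "s \<in> range (\<lambda>n. zpow f n p)"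
    then show "f s \<in> range (\<lambda>n. zpow f n p)"
      using zpow_step [OF that] by blast
  qed
  then show "U s \<in> orbU \<longleftrightarrow> s \<in> orbU" "T s \<in> orbT \<longleftrightarrow> s \<in> orbT"
    using bij_U bij_T by (simp_all add: orbU_def orbT_def)
qed

lemma p_orb: "p \<in> orbU" "p \<in> orbT" "UtoT p = p"
proof -
  have "p = zpow U 0 p" "p = zpow T 0 p" by simp_all
  then show "p \<in> orbU" "p \<in> orbT"
    unfolding orbU_def orbT_def by blast+
  show "UtoT p = p" using UtoT [of 0] by simp
qed

text \<open>The new permutation \<open>newY\<close> of \<open>'a \<times> int\<close> has to conjugate \<open>U\<close> to \<open>T\<close> and to fix \<open>(p, 0)\<close>.
  On level \<open>0\<close> it maps \<open>U\<^sup>n p\<close> to \<open>T\<^sup>n p\<close>. All other points are shifted from one level to the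
  next, apart from the superfluous copies of the two orbits; this conjugates \<open>U\<close> to \<open>T\<close> because
  \<open>T\<close> acts on the positive levels as \<open>U\<close> does on level \<open>0\<close>, and on the negative levels \<open>U\<close> acts
  as \<open>T\<close> does on level \<open>0\<close>.\<close>

definition newT :: "'a \<times> int \<Rightarrow> 'a \<times> int" where
  "newT = (\<lambda>(s, n). (if n \<le> 0 then T s else U s, n))"

definition newY :: "'a \<times> int \<Rightarrow> 'a \<times> int" where
  "newY = (\<lambda>(s, n).
     if n < 0 then (if s \<in> orbT then (s, n) else (s, n + 1))
     else if s \<in> orbU then (if n = 0 then (UtoT s, 0) else (s, n)) else (s, n + 1))"

definition newY_inv :: "'a \<times> int \<Rightarrow> 'a \<times> int" where
  "newY_inv = (\<lambda>(s, n).
     if n > 0 then (if s \<in> orbU then (s, n) else (s, n - 1))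
     else if s \<in> orbT then (if n = 0 then (TtoU s, 0) else (s, n)) else (s, n - 1))"

text \<open>Off level 0 every \<open>oldY i\<close> is the inverse of \<open>newT\<close>. There
  both sides of \<open>comm\<close> and of \<open>conj\<close> are the identity, and
  \<open>newT o oldY k o newT\<close> is \<open>newT\<close> itself.\<close>

definition oldY :: "nat \<Rightarrow> 'a \<times> int \<Rightarrow> 'a \<times> int" where
  "oldY i = (\<lambda>(s, n). (if n = 0 then Y i s else if n < 0 then finv T s else finv U s, n))"

definition extY :: "nat \<Rightarrow> 'a \<times> int \<Rightarrow> 'a \<times> int" where
  "extY i = (if i = Suc k then newY else oldY i)"

lemma bij_levels:
  assumes "\<And>n. bij (f n)"
  shows "bij (\<lambda>(s, n). (f n s, n))"
proof (rule o_bij)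
  show "(\<lambda>(s, n). (finv (f n) s, n)) \<circ> (\<lambda>(s, n). (f n s, n)) = id"
    using assms by (auto simp: fun_eq_iff bij_is_inj)
  show "(\<lambda>(s, n). (f n s, n)) \<circ> (\<lambda>(s, n). (finv (f n) s, n)) = id"
    using assms by (auto simp: fun_eq_iff bij_is_surj surj_f_inv_f)
qed

lemma bij_newY: "bij newY"
proof (rule o_bij)
  show "newY_inv \<circ> newY = id"
    by (auto simp: fun_eq_iff newY_def newY_inv_def orb_maps)
  show "newY \<circ> newY_inv = id"
    by (auto simp: fun_eq_iff newY_def newY_inv_def orb_maps)
qed

lemma bij_newT: "bij newT"
proof -
  have "bij (if n \<le> 0 then T else U)" for n :: int
    by (simp add: bij_T bij_U)
  from bij_levels [OF this] show ?thesis
    by (simp add: newT_def if_distrib [of "\<lambda>f. f _"] cong: if_cong)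
qed

lemma bij_oldY:
  assumes "1 \<le> i" "i \<le> k"
  shows "bij (oldY i)"
proof -
  have "bij (if n = 0 then Y i else if n < 0 then finv T else finv U)" for n :: int
    by (simp add: bij_T bij_U bij_Y [OF assms] bij_imp_bij_inv)
  from bij_levels [OF this] show ?thesis
    by (simp add: oldY_def if_distrib [of "\<lambda>f. f _"] cong: if_cong)
qed

lemma inv_simps [simp]:
  "T (finv T s) = s" "finv T (T s) = s" "U (finv U s) = s" "finv U (U s) = s"
  using bij_T bij_U by (simp_all add: bij_is_inj bij_is_surj surj_f_inv_f)

lemma newT_oldY_newT:
  "newT (oldY k (newT (s, n))) = (if n < 0 then T s else U s, n)"
  by (simp add: newT_def oldY_def) (simp add: U_def)

text \<open>On level 0, \<open>UtoT\<close> turns \<open>U\<close> into \<open>T\<close>, and points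
  outside \<open>orbU\<close> move to level 1, where \<open>newT\<close> is \<open>U\<close>. On the
  other levels the case distinction of \<open>newY\<close> is invariant by
  \<open>orb_step\<close>.\<close>

lemma newY_conj: "newT (newY x) = newY (newT (oldY k (newT x)))"
proof (cases x)
  case (Pair s n)
  consider "n < 0" | "n = 0" | "n > 0"
    by linarith
  then show ?thesis
    unfolding Pair newT_oldY_newT
    by cases (simp_all add: newY_def newT_def orb_step orb_maps)
qed

lemma newT_pow: "(newT ^^ n) (s, 0) = ((T ^^ n) s, 0)"
  by (induction n) (simp_all add: newT_def)

text \<open>A trap for the new \<open>U\<close>, which serves to prove \<open>pos\<close> for the
  extension: it omits \<open>(p, 0)\<close>, and the new \<open>U\<close> maps it and
  \<open>(p, 0)\<close> into it.\<close>

definition forward :: "('a \<times> int) set" where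
  "forward = {((T ^^ n) p, 0) |n. n > 0} \<union> {(s, n). n > 0}"

lemma p_not_forward: "(p, 0) \<notin> forward"
proof
  assume "(p, 0) \<in> forward"
  then obtain n where "n > 0" "(p, 0::int) = ((T ^^ n) p, 0)"
    unfolding forward_def by blast
  then have "(T ^^ n) p = p"
    by (metis Pair_inject)
  then show False
    using pos [of 0 n] \<open>n > 0\<close> by simp
qed

text \<open>This is where \<open>pos\<close> is needed for mixed exponents:
  \<open>T^(n+1) p = U^j p\<close> with \<open>j <= 0\<close> would give
  \<open>U^(-j) T^(n+1) p = p\<close>.\<close>

lemma orbU_forward:
  assumes "(T ^^ Suc n) p \<in> orbU"
  obtains m where "m > 0" "(T ^^ Suc n) p = (U ^^ m) p"
proof -
  from assms obtain j where j: "(T ^^ Suc n) p = zpow U j p"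
    by (auto simp: orbU_def)
  have "j > 0"
  proof (rule ccontr)
    assume "\<not> j > 0"
    then have "(U ^^ nat (- j)) ((T ^^ Suc n) p) = zpow U (- j) (zpow U j p)"
      using j by (simp add: zpow_def)
    also have "\<dots> = p"
      by (simp add: zpow_add bij_U)
    finally show False
      using pos [of "nat (- j)" "Suc n"] by (simp add: U_def)
  qed
  then show ?thesis
    using j by (intro that [of "nat j"]) (simp_all add: zpow_def)
qed

text \<open>On level 0, a point \<open>T^(n+1) p\<close> in \<open>orbU\<close> is some
  \<open>U^m p\<close> with \<open>m > 0\<close>, which \<open>newY\<close> sends to
  \<open>T^m p\<close>; outside \<open>orbU\<close> it rises to level 1. Positive levels are never
  left downwards.\<close>

lemma newU_forward:
  assumes "x = (p, 0) \<or> x \<in> forward"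
  shows "(newT \<circ> newY \<circ> newT) x \<in> forward"
proof -
  consider n where "x = ((T ^^ n) p, 0)" | s n where "x = (s, n)" "n > 0"
    using assms by (auto simp: forward_def) (metis funpow_0)
  then show ?thesis
  proof cases
    case (1 n)
    then have x: "newT x = ((T ^^ Suc n) p, 0)"
      by (simp add: newT_def)
    show ?thesis
    proof (cases "(T ^^ Suc n) p \<in> orbU")
      case True
      then obtain m where m: "m > 0" "(T ^^ Suc n) p = (U ^^ m) p"
        by (rule orbU_forward)
      then have "newY (newT x) = ((T ^^ m) p, 0)"
        using True x UtoT [of "int m"] by (simp add: newY_def)
      then have "(newT \<circ> newY \<circ> newT) x = ((T ^^ Suc m) p, 0)"
        by (simp add: newT_def)
      then show ?thesis
        unfolding forward_def by blast
    next
      case False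
      then show ?thesis
        using x by (simp add: newY_def newT_def forward_def)
    qed
  next
    case 2
    then show ?thesis
      by (simp add: newY_def newT_def forward_def)
  qed
qed

lemma extended: "hydra_perms (Suc k) newT extY (p, 0)"
proof
  show "bij (extY i)" if "1 \<le> i" "i \<le> Suc k" for i
    using that bij_newY bij_oldY by (simp add: extY_def)
  show "extY i (p, 0) = (p, 0)" if "1 \<le> i" "i \<le> Suc k" for i
    using that fixp p_orb by (simp add: extY_def newY_def oldY_def)
  show "newT (extY 1 x) = extY 1 (newT x)" for x
    using k comm by (cases x) (simp add: extY_def newT_def oldY_def)
  show "newT (extY i x) = extY i (newT (extY (i - 1) (newT x)))" if "1 < i" "i \<le> Suc k" for i x
  proof (cases "i = Suc k")
    case True
    then show ?thesis
      using newY_conj by (simp add: extY_def)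
  next
    case False
    obtain s n where "x = (s, n)"
      by (cases x)
    have "T (Y i s) = Y i (T (Y (i - 1) (T s)))"
      using False that by (intro conj) simp_all
    moreover have "i - 1 \<noteq> Suc k"
      using that by linarith
    then have "extY i = oldY i" "extY (i - 1) = oldY (i - 1)"
      using False by (simp_all add: extY_def)
    moreover have "n = 0 \<or> n < 0 \<or> n > 0"
      by linarith
    ultimately show ?thesis
      unfolding \<open>x = (s, n)\<close> by (elim disjE) (simp_all add: newT_def oldY_def)
  qed
  \<comment> \<open>For \<open>m = 0\<close> this is the old \<open>pos\<close> on level 0.
    Otherwise the first new \<open>U\<close> leads into \<open>forward\<close>, and the later ones
    stay there.\<close>
  show "((newT \<circ> extY (Suc k) \<circ> newT) ^^ m) ((newT ^^ n) (p, 0)) \<noteq> (p, 0)" if "0 < m + n" for m n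
  proof (cases m)
    case 0
    then show ?thesis
      using that pos [of 0 n] by (simp add: newT_pow)
  next
    case (Suc m')
    have "(newT ^^ n) (p, 0) = (p, 0) \<or> (newT ^^ n) (p, 0) \<in> forward"
      unfolding newT_pow forward_def by (cases "n = 0") auto
    then have "((newT \<circ> newY \<circ> newT) ^^ Suc m') ((newT ^^ n) (p, 0)) \<in> forward"
      by (induction m') (simp_all add: newU_forward [unfolded comp_def] comp_def)
    then show ?thesis
      using p_not_forward Suc by (auto simp: extY_def)
  qed
qed (simp_all add: bij_newT)

text \<open>\<open>newY\<close> moves \<open>T p\<close> to level 1, where \<open>extY 1\<close>
  acts as the inverse of \<open>U\<close>. For \<open>k = 1\<close> the map \<open>newY\<close> is
  \<open>extY 2\<close>, which starts the induction.\<close>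

lemma new_witness:
  assumes "T p \<notin> orbU" "U (T p) \<noteq> T p"
  shows "extY 1 (newY (newT (p, 0))) \<noteq> newY (newT (p, 0))"
proof -
  have "newY (newT (p, 0)) = (T p, 1)"
    using assms(1) by (simp add: newT_def newY_def)
  moreover have "finv U (T p) \<noteq> T p"
    using assms(2) inv_simps(3) by metis
  then have "extY 1 (T p, 1) \<noteq> (T p, 1)"
    using k by (simp add: extY_def oldY_def)
  ultimately show ?thesis
    by (simp only: not_False_eq_True)
qed

text \<open>Level 0 carries the old action, so the inequality persists in later extensions.\<close>

lemma old_witness:
  assumes "1 < k"
  shows "extY 1 (extY 2 (newT (p, 0))) = (Y 1 (Y 2 (T p)), 0)" "extY 2 (newT (p, 0)) = (Y 2 (T p), 0)"
  using assms by (simp_all add: newT_def extY_def oldY_def)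

end

section \<open>Existence of the permutations for all \<open>k >= 2\<close>\<close>

lemma hydra_perms_transport:
  assumes "hydra_perms k T Y p" "bij e"
  shows "hydra_perms k (e \<circ> T \<circ> finv e) (\<lambda>i. e \<circ> Y i \<circ> finv e) (e p)"
proof -
  interpret hydra_perms k T Y p by fact
  have e: "finv e (e s) = s" "e (finv e z) = z" for s z
    using \<open>bij e\<close> by (simp_all add: bij_is_inj bij_is_surj surj_f_inv_f)
  have bij: "bij (e \<circ> f \<circ> finv e)" if "bij f" for f
    using that \<open>bij e\<close> by (simp add: bij_comp bij_imp_bij_inv)
  have pow: "((e \<circ> f \<circ> finv e) ^^ n) (e s) = e ((f ^^ n) s)" for f n s
    by (induction n) (simp_all add: e)
  have "(e \<circ> T \<circ> finv e) \<circ> (e \<circ> Y k \<circ> finv e) \<circ> (e \<circ> T \<circ> finv e) = e \<circ> (T \<circ> Y k \<circ> T) \<circ> finv e"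
    by (simp add: fun_eq_iff e)
  then show ?thesis
    using k bij_T bij_Y fixp comm conj pos bij_is_inj [OF \<open>bij e\<close>]
    by unfold_locales (auto simp: bij pow e inj_eq simp del: funpow.simps)
qed

text \<open>Here \<open>T\<close> and \<open>U\<close> are translations by 1 and 2, so any nonempty
  product of them moves 0 to the right.\<close>

lemma hydra_perms_base: "hydra_perms 1 (\<lambda>z::int. z + 1) (\<lambda>i. id) 0"
proof
  show "bij (\<lambda>z::int. z + 1)"
    by (rule o_bij [of "\<lambda>z. z - 1"]) auto
  have "((\<lambda>z::int. z + 1) ^^ n) x = x + int n" for n x
    by (induction n) simp_all
  moreover have "(((\<lambda>z::int. z + 1) \<circ> id \<circ> (\<lambda>z. z + 1)) ^^ m) x = x + 2 * int m" for m x
    by (induction m) simp_all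
  ultimately show "(((\<lambda>z::int. z + 1) \<circ> id \<circ> (\<lambda>z. z + 1)) ^^ m) (((\<lambda>z. z + 1) ^^ n) 0) \<noteq> 0"
    if "0 < m + n" for m n
    using that by auto
qed simp_all

lemma hydra_perms_exist:
  assumes "2 \<le> k"
  shows "\<exists>T Y (p::int). hydra_perms k T Y p \<and> Y 1 (Y 2 (T p)) \<noteq> Y 2 (T p)"
proof -
  \<comment> \<open>An extension step passes from \<open>int\<close> to \<open>int * int\<close>;
    the bijection \<open>e\<close> leads back, so that the induction stays on one type.\<close>
  have "infinite (UNIV :: (int \<times> int) set)"
    using infinite_UNIV_int finite_prod by blast
  then obtain e0 :: "int \<times> int \<Rightarrow> nat" where "bij e0"
    using countableE_infinite [OF countableI_type] by blast
  obtain e1 :: "int \<Rightarrow> nat" where "bij e1"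
    using countableE_infinite [OF countableI_type infinite_UNIV_int] by blast
  define e where "e = finv e1 \<circ> e0"
  have e: "bij e"
    using \<open>bij e0\<close> \<open>bij e1\<close> by (simp add: e_def bij_comp bij_imp_bij_inv)
  have e_simps: "finv e (e x) = x" "e x = e y \<longleftrightarrow> x = y" for x y
    using e by (simp_all add: bij_is_inj inj_eq)
  have transport: "\<exists>T Y (p::int). hydra_perms k T Y p \<and> Y 1 (Y 2 (T p)) \<noteq> Y 2 (T p)"
    if "hydra_perms k T Y p" "Y 1 (Y 2 (T p)) \<noteq> Y 2 (T p)" for k T Y and p :: "int \<times> int"
  proof (intro exI conjI)
    show "hydra_perms k (e \<circ> T \<circ> finv e) (\<lambda>i. e \<circ> Y i \<circ> finv e) (e p)"
      using that(1) e by (rule hydra_perms_transport)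
  qed (use that(2) in \<open>simp add: e_simps\<close>)
  show ?thesis
    using assms
  proof (induction k rule: dec_induct)
    case base
    interpret hydra_perms 1 "\<lambda>z::int. z + 1" "\<lambda>i. id" 0
      by (rule hydra_perms_base)
    have U: "U = (\<lambda>z. z + 2)"
      unfolding U_def by auto
    have pow: "((\<lambda>z::int. z + 2) ^^ m) 0 = 2 * int m" for m
      by (induction m) simp_all
    \<comment> \<open>The point \<open>T 0 = 1\<close> is odd, while the \<open>U\<close>-orbit of 0
      consists of even numbers.\<close>
    have "(0::int) + 1 \<notin> orbU"
    proof
      assume "(0::int) + 1 \<in> orbU"
      then have "((\<lambda>z::int. z + 1) ^^ Suc 0) 0 \<in> orbU"
        by (simp only: funpow.simps comp_apply id_apply)
      then obtain m where "((\<lambda>z::int. z + 1) ^^ Suc 0) 0 = (U ^^ m) 0"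
        by (rule orbU_forward)
      then have "1 = 2 * int m"
        unfolding U pow by simp
      then show False
        by presburger
    qed
    moreover have "U (0 + 1) \<noteq> 0 + 1"
      unfolding U by simp
    ultimately have "extY 1 (newY (newT (0, 0))) \<noteq> newY (newT (0, 0))"
      by (rule new_witness)
    moreover have "extY 2 = newY"
      unfolding extY_def by (metis Suc_1)
    ultimately have "extY 1 (extY 2 (newT (0, 0))) \<noteq> extY 2 (newT (0, 0))"
      by metis
    with extended [unfolded Suc_1] show ?case
      by (rule transport)
  next
    case (step k)
    then obtain T Y and p :: int where "hydra_perms k T Y p"
      and ne: "Y 1 (Y 2 (T p)) \<noteq> Y 2 (T p)"
      by blast
    then interpret hydra_perms k T Y p by blast
    have "1 < k"
      using step.hyps by simp
    from extended show ?case
      by (rule transport) (use ne old_witness [OF \<open>1 < k\<close>] in simp)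
  qed
qed

section \<open>The double of a hydra group\<close>

lemma carrier_BijGroup_UNIV: "carrier (BijGroup UNIV) = {f. bij f}"
  by (auto simp: BijGroup_def Bij_def)

lemma mult_BijGroup_UNIV:
  "bij f \<Longrightarrow> bij g \<Longrightarrow> f \<otimes>\<^bsub>BijGroup UNIV\<^esub> g = f \<circ> g"
  by (auto simp: BijGroup_def Bij_def compose_def fun_eq_iff)

lemma inv_BijGroup_UNIV:
  "bij f \<Longrightarrow> inv\<^bsub>BijGroup UNIV\<^esub> f = finv f"
  by (subst inv_BijGroup) (auto simp: Bij_def)

text \<open>The image of \<open>t^-1\<close> is kept as a unit because it is \<open>A\<close> in
  \<open>finite_twisted_eq\<close> and \<open>T\<close> in \<open>hydra_perms\<close>.\<close>

lemma hom_hydra_witness: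
  assumes "group L" "h \<in> hom (hydra k) L" "k > 1"
  shows "h (hydra_witness k) = inv\<^bsub>L\<^esub> (h (inv\<^bsub>hydra k\<^esub> hydra_t k)) \<otimes>\<^bsub>L\<^esub>
    (inv\<^bsub>L\<^esub> (h (hydra_at k 2)) \<otimes>\<^bsub>L\<^esub> (h (hydra_at k 1) \<otimes>\<^bsub>L\<^esub>
    (h (hydra_at k 2) \<otimes>\<^bsub>L\<^esub> h (inv\<^bsub>hydra k\<^esub> hydra_t k))))"
proof -
  interpret group_hom "hydra k" L h
    using assms group_hydra by (simp add: group_hom_def group_hom_axioms_def)
  have "hydra_at k 1 \<in> carrier (hydra k)" "hydra_at k 2 \<in> carrier (hydra k)"
    using assms by (simp_all add: hydra_at_carrier)
  then show ?thesis
    by (simp add: hydra_witness_def)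
qed

lemma finite_homs_agree:
  assumes L: "group L" "finite (carrier L)"
    and f: "f \<in> hom (hydra k) L" and g: "g \<in> hom (hydra k) L" and k: "k > 1"
    and eq: "\<And>i. 1 \<le> i \<Longrightarrow> i \<le> k \<Longrightarrow> f (hydra_at k i) = g (hydra_at k i)"
  shows "f (hydra_witness k) = g (hydra_witness k)"
proof -
  interpret H: group "hydra k" by (rule group_hydra)
  interpret L: group L by fact
  define s where "s = inv\<^bsub>hydra k\<^esub> hydra_t k"
  have s: "s \<in> carrier (hydra k)"
    by (simp add: s_def)
  have at: "hydra_at k 1 \<in> carrier (hydra k)" "hydra_at k 2 \<in> carrier (hydra k)"
    using k by (simp_all add: hydra_at_carrier)
  have rel1: "h s \<otimes>\<^bsub>L\<^esub> h (hydra_at k 1) = h (hydra_at k 1) \<otimes>\<^bsub>L\<^esub> h s"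
    and rel2: "h s \<otimes>\<^bsub>L\<^esub> h (hydra_at k 2) =
      h (hydra_at k 2) \<otimes>\<^bsub>L\<^esub> (h s \<otimes>\<^bsub>L\<^esub> (h (hydra_at k 1) \<otimes>\<^bsub>L\<^esub> h s))"
    if h: "h \<in> hom (hydra k) L" for h
    using hydra_at_comm [of k] hydra_at_rel [of 2 k] k s at
    by (simp_all add: s_def flip: hom_mult [OF h])
  have eq12: "f (hydra_at k 1) = g (hydra_at k 1)" "f (hydra_at k 2) = g (hydra_at k 2)"
    using eq k by simp_all
  note closed = hom_in_carrier [OF f] hom_in_carrier [OF g]
  show ?thesis
    unfolding hom_hydra_witness [OF L(1) f k] hom_hydra_witness [OF L(1) g k] eq12 s_def [symmetric]
    using rel1 [OF f] rel2 [OF f] rel1 [OF g] rel2 [OF g] unfolding eq12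
    by (intro L.finite_twisted_eq L(2) closed s at)
qed

text \<open>The permutations act on the first factor of \<open>int \<times> bool\<close>. Conjugation by the transposition of
  \<open>(p, False)\<close> and \<open>(p, True)\<close> does not affect those that fix \<open>p\<close>, but it changes those that
  move \<open>p\<close>.\<close>

lemma homs_disagree:
  assumes gt: "k > 1"
  obtains f g :: "hydra_gen gword set \<Rightarrow> int \<times> bool \<Rightarrow> int \<times> bool"
  where "f \<in> hom (hydra k) (BijGroup UNIV)" "g \<in> hom (hydra k) (BijGroup UNIV)"
    and "\<And>i. 1 \<le> i \<Longrightarrow> i \<le> k \<Longrightarrow> f (hydra_at k i) = g (hydra_at k i)"
    and "f (hydra_witness k) \<noteq> g (hydra_witness k)"
proof -
  obtain T Y and p :: int where "hydra_perms k T Y p"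
    and ne: "Y 1 (Y 2 (T p)) \<noteq> Y 2 (T p)"
    using hydra_perms_exist [of k] gt by (metis Suc_1 Suc_leI)
  interpret hydra_perms k T Y p by fact
  define L :: "(int \<times> bool \<Rightarrow> int \<times> bool) monoid" where "L = BijGroup UNIV"
  interpret L: group L
    by (simp add: L_def group_BijGroup)
  define lift :: "(int \<Rightarrow> int) \<Rightarrow> int \<times> bool \<Rightarrow> int \<times> bool" where "lift q = map_prod q id" for q
  have bij_lift: "bij (lift q)" if "bij q" for q
    using that bij_betw_map_prod [of q UNIV UNIV id UNIV UNIV] by (simp add: lift_def)
  have carrL: "q \<in> carrier L \<longleftrightarrow> bij q" for q
    by (simp add: L_def carrier_BijGroup_UNIV)
  have multL: "q \<otimes>\<^bsub>L\<^esub> r = q \<circ> r" if "bij q" "bij r" for q r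
    using that by (simp add: L_def mult_BijGroup_UNIV)
  have invL: "inv\<^bsub>L\<^esub> q = finv q" if "bij q" for q
    using that by (simp add: L_def inv_BijGroup_UNIV)
  have lift_comp: "lift q \<circ> lift r = lift (q \<circ> r)" for q r
    by (simp add: lift_def fun_eq_iff)
  obtain f where f: "f \<in> hom (hydra k) L" "f (hydra_t k) = inv\<^bsub>L\<^esub> (lift T)"
    "\<And>i. 1 \<le> i \<Longrightarrow> i \<le> k \<Longrightarrow> f (hydra_at k i) = lift (Y i)"
  proof (rule L.hydra_lift [of "lift T" k "\<lambda>i. lift (Y i)"])
    show "lift T \<otimes>\<^bsub>L\<^esub> lift (Y 1) = lift (Y 1) \<otimes>\<^bsub>L\<^esub> lift T"
    proof -
      have "bij (Y 1)"
        using k by (intro bij_Y) simp_all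
      moreover have "T \<circ> Y 1 = Y 1 \<circ> T"
        using comm by (simp add: fun_eq_iff)
      ultimately show ?thesis
        by (simp only: multL bij_lift bij_T lift_comp)
    qed
    show "lift T \<otimes>\<^bsub>L\<^esub> lift (Y i) = lift (Y i) \<otimes>\<^bsub>L\<^esub> (lift T \<otimes>\<^bsub>L\<^esub> (lift (Y (i - 1)) \<otimes>\<^bsub>L\<^esub> lift T))"
      if "1 < i" "i \<le> k" for i
    proof -
      have "bij (Y i)" "bij (Y (i - 1))"
        using that by (simp_all add: bij_Y)
      moreover have "T \<circ> Y i = Y i \<circ> (T \<circ> (Y (i - 1) \<circ> T))"
        using conj [OF that] by (simp add: fun_eq_iff)
      ultimately show ?thesis
        by (simp add: multL bij_lift bij_T bij_comp lift_comp)
    qed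
  qed (use k in \<open>simp_all add: carrL bij_lift bij_T bij_Y\<close>)
  define \<sigma> where "\<sigma> = transpose (p, False) (p, True)"
  have \<sigma>: "bij \<sigma>" "\<sigma> (\<sigma> x) = x" for x
    by (simp_all add: \<sigma>_def)
  define g where "g x = \<sigma> \<circ> f x \<circ> \<sigma>" for x
  have f_bij: "bij (f x)" if "x \<in> carrier (hydra k)" for x
    using hom_in_carrier [OF f(1) that] by (simp add: carrL)
  have "g \<in> hom (hydra k) L"
  proof (rule homI)
    fix x y assume xy: "x \<in> carrier (hydra k)" "y \<in> carrier (hydra k)"
    have "\<sigma> \<circ> (f x \<circ> f y) \<circ> \<sigma> = (\<sigma> \<circ> f x \<circ> \<sigma>) \<circ> (\<sigma> \<circ> f y \<circ> \<sigma>)"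
      by (simp add: fun_eq_iff \<sigma>)
    then show "g (x \<otimes>\<^bsub>hydra k\<^esub> y) = g x \<otimes>\<^bsub>L\<^esub> g y"
      using xy by (simp add: g_def hom_mult [OF f(1)] multL f_bij bij_comp \<sigma>)
  qed (simp add: g_def carrL f_bij bij_comp \<sigma>)
  moreover have "f (hydra_at k i) = g (hydra_at k i)" if "1 \<le> i" "i \<le> k" for i
  proof -
    \<comment> \<open>By injectivity \<open>Y i\<close> preserves the complement of \<open>p\<close>
      too, so \<open>lift (Y i)\<close> commutes with the transposition.\<close>
    have "inj (Y i)" "Y i p = p"
      using bij_Y fixp that by (simp_all add: bij_is_inj)
    then have "Y i s = p \<longleftrightarrow> s = p" for s
      by (metis injD)
    then have "lift (Y i) (\<sigma> (s, b)) = \<sigma> (lift (Y i) (s, b))" for s b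
      using \<open>Y i p = p\<close> by (auto simp: lift_def \<sigma>_def transpose_def)
    then have "\<sigma> \<circ> lift (Y i) \<circ> \<sigma> = lift (Y i)"
      by (simp add: fun_eq_iff \<sigma>)
    then show ?thesis
      using that by (simp add: g_def f(3))
  qed
  moreover have "f (hydra_witness k) \<noteq> g (hydra_witness k)"
  proof
    assume eq: "f (hydra_witness k) = g (hydra_witness k)"
    define q where "q = finv T \<circ> (finv (Y 2) \<circ> (Y 1 \<circ> (Y 2 \<circ> T)))"
    have bij: "bij T" "bij (Y 1)" "bij (Y 2)"
      using bij_T bij_Y gt by simp_all
    have finv_lift: "finv (lift r) = lift (finv r)" if "bij r" for r
      using that bij_lift [OF that]
      by (intro inv_equality) (auto simp: lift_def bij_is_inj bij_is_surj surj_f_inv_f)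
    interpret f: group_hom "hydra k" L f
      using f(1) group_hydra by (simp add: group_hom_def group_hom_axioms_def)
    have "f (inv\<^bsub>hydra k\<^esub> hydra_t k) = lift T"
      using f(2) bij by (simp add: carrL bij_lift)
    then have "f (hydra_witness k) = lift q"
      using bij gt
      by (simp add: hom_hydra_witness [OF L.is_group f(1) gt] f(3) invL multL bij_lift finv_lift
          bij_comp bij_imp_bij_inv lift_comp q_def)
    moreover have "g (hydra_witness k) = \<sigma> \<circ> f (hydra_witness k) \<circ> \<sigma>"
      by (simp add: g_def)
    ultimately have "lift q (p, False) = \<sigma> (lift q (\<sigma> (p, False)))"
      using eq by (metis comp_apply)
    \<comment> \<open>The inequality \<open>ne\<close> says that \<open>q\<close> moves
      \<open>p\<close>. Then the left side above is \<open>(q p, False)\<close>, but the right side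
      is \<open>(q p, True)\<close>, which the transposition fixes.\<close>
    moreover have "q p \<noteq> p"
      using ne bij by (simp add: q_def) (metis bij_inv_eq_iff)
    ultimately show False
      by (simp add: lift_def \<sigma>_def transpose_def)
  qed
  ultimately show ?thesis
    using f(1) that unfolding L_def by blast
qed

theorem theorem1p2:
  fixes k :: nat
  assumes "k > 1"
  shows "\<not> residually_finite (hydra_double k)"
proof
  assume rf: "residually_finite (hydra_double k)"
  let ?E = "{(hydra_at k i, hydra_at k i) | i. 1 \<le> i \<and> i \<le> k}"
  define D where "D = hydra_double k"
  define l where "l = amalgam_inl (hydra k) (hydra k) ?E"
  define r where "r = amalgam_inr (hydra k) (hydra k) ?E"
  define w where "w = hydra_witness k"
  have D_eq: "D = amalgam (hydra k) (hydra k) ?E"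
    by (simp add: D_def hydra_double_def)
  interpret D: group D
    by (simp add: D_eq group_amalgam)
  have l: "l \<in> hom (hydra k) D" and r: "r \<in> hom (hydra k) D"
    by (simp_all add: l_def r_def D_eq amalgam_inl_hom amalgam_inr_hom group_hydra)
  have lr: "l (hydra_at k i) = r (hydra_at k i)" if "1 \<le> i" "i \<le> k" for i
    unfolding l_def r_def using that by (intro amalgam_inl_eq_inr hydra_at_carrier) auto
  have w: "w \<in> carrier (hydra k)"
    using assms by (simp add: w_def hydra_witness_carrier)
  have lw: "l w \<in> carrier D" and rw: "r w \<in> carrier D"
    using w l r by (auto simp: hom_def)
  have "l w \<noteq> r w"
  proof
    assume "l w = r w"
    obtain f g :: "hydra_gen gword set \<Rightarrow> int \<times> bool \<Rightarrow> int \<times> bool" where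
      fg: "f \<in> hom (hydra k) (BijGroup UNIV)" "g \<in> hom (hydra k) (BijGroup UNIV)"
      "\<And>i. 1 \<le> i \<Longrightarrow> i \<le> k \<Longrightarrow> f (hydra_at k i) = g (hydra_at k i)" "f w \<noteq> g w"
      using homs_disagree [OF assms] unfolding w_def by metis
    obtain h where "\<And>x. x \<in> carrier (hydra k) \<Longrightarrow> h (l x) = f x"
      "\<And>x. x \<in> carrier (hydra k) \<Longrightarrow> h (r x) = g x"
      unfolding l_def r_def
      by (rule group.amalgam_lift [OF group_BijGroup fg(1,2), of ?E]) (use fg(3) in auto)
    then show False
      using \<open>l w = r w\<close> w fg(4) by metis
  qed
  \<comment> \<open>A nontrivial element that dies in every finite quotient, since
    \<open>finite_homs_agree\<close> applies to the two copies of the hydra group there.\<close>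
  define x where "x = l w \<otimes>\<^bsub>D\<^esub> inv\<^bsub>D\<^esub> r w"
  have "x \<in> carrier D" "x \<noteq> \<one>\<^bsub>D\<^esub>"
    using lw rw \<open>l w \<noteq> r w\<close> D.inv_solve_right' [of "\<one>\<^bsub>D\<^esub>" "l w" "r w"] by (auto simp: x_def)
  then obtain N where "N \<lhd> D" and fin: "finite (carrier (D Mod N))"
    and N: "N #>\<^bsub>D\<^esub> x \<noteq> \<one>\<^bsub>D Mod N\<^esub>"
    using rf unfolding residually_finite_def D_def by blast
  interpret normal N D by fact
  define q where "q = (\<lambda>a. N #>\<^bsub>D\<^esub> a)"
  have q: "q \<in> hom D (D Mod N)"
    using r_coset_hom_Mod by (simp add: q_def)
  interpret Q: group "D Mod N" by (rule factorgroup_is_group)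
  interpret q: group_hom D "D Mod N" q
    using q by (simp add: group_hom_def group_hom_axioms_def D.is_group Q.is_group)
  have "(q \<circ> l) (hydra_witness k) = (q \<circ> r) (hydra_witness k)"
    by (rule finite_homs_agree [OF Q.is_group fin hom_compose [OF l q] hom_compose [OF r q] assms])
      (simp add: lr)
  then have "q (l w) = q (r w)"
    by (simp add: w_def)
  then have "q x = q (r w) \<otimes>\<^bsub>D Mod N\<^esub> inv\<^bsub>D Mod N\<^esub> q (r w)"
    using lw rw unfolding x_def by (simp only: q.hom_mult q.hom_inv D.inv_closed)
  also have "\<dots> = \<one>\<^bsub>D Mod N\<^esub>"
    using rw by (intro Q.r_inv q.hom_closed)
  finally have "q x = \<one>\<^bsub>D Mod N\<^esub>" .
  with N show False
    by (simp add: q_def)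
qed

end
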